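(* Let $n\ge2$ and let $0\to\mathfrak g\xrightarrow{i}E\xrightarrow{p}V\to0$ be a short exact sequence of $n$-Lie algebras, with $\mathfrak g$ identified with $i(\mathfrak g)$, which is sparse relative to a linear section $\sigma:V\to E$ of $p$. Define $$\vartheta_V(u)(x_2,\dots,x_n)=[\sigma(u),x_2,\dots,x_n]_E,\qquad\rho_V(u_1,\dots,u_{n-1})x=[\sigma(u_1),\dots,\sigma(u_{n-1}),x]_E,$$ $$\omega(u_1,\dots,u_n)=[\sigma(u_1),\dots,\sigma(u_n)]_E-\sigma([u_1,\dots,u_n]_V),$$ all of which take values in $\mathfrak g$. Then the linear isomorphism $\Phi:\mathfrak g\oplus V\to E$, $\Phi(x+u)=x+\sigma(u)$, is an $n$-Lie algebra isomorphism $\mathfrak g\#_{\rho_V,\vartheta_V,\omega}V\cong E$. Conversely, every crossed product gives a sparse non-abelian extension $$0\to\mathfrak g\to\mathfrak g\#_{\rho_V,\vartheta_V,\omega}V\to V\to0$$ (with the canonical inclusion $x\mapsto x+0$ and projection $x+u\mapsto u$, sparse relative to the canonical section $u\mapsto 0+u$).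
   Context: $K$ is a field of characteristic zero; vector spaces are over $K$, all maps are linear; a hat denotes omission. An $n$-Lie algebra is a vector space with an alternating $n$-linear bracket (an $n$-Lie bracket) satisfying $[z_1,\dots,z_{n-1},[w_1,\dots,w_n]]=\sum_{i=1}^n[w_1,\dots,w_{i-1},[z_1,\dots,z_{n-1},w_i],w_{i+1},\dots,w_n]$. A linear section of $p$ is a linear map $\sigma:V\to E$ with $p\sigma=\mathrm{id}_V$. The extension is sparse relative to $\sigma$ if $[\sigma(u_1),\dots,\sigma(u_k),x_{k+1},\dots,x_n]_E=0$ for all $2\le k\le n-2$, $u_i\in V$, $x_j\in\mathfrak g$. Given $n$-Lie algebras $\mathfrak g,V$ and linear maps $\rho_V:\bigwedge^{n-1}V\to\mathrm{End}(\mathfrak g)$, $\vartheta_V:V\to\mathrm{Hom}(\bigwedge^{n-1}\mathfrak g,\mathfrak g)$, $\omega:\bigwedge^nV\to\mathfrak g$, the crossed-product operation on $\mathfrak g\oplus V$ is $$\begin{aligned}[x_1+u_1,\dots,x_n+u_n]_{\rho_V,\vartheta_V,\omega}={}&[x_1,\dots,x_n]_{\mathfrak g}+[u_1,\dots,u_n]_V+\omega(u_1,\dots,u_n)\\&+\sum_{i=1}^n(-1)^{i-1}\vartheta_V(u_i)(x_1,\dots,\widehat{x_i},\dots,x_n)+\sum_{i=1}^n(-1)^{n-i}\rho_V(u_1,\dots,\widehat{u_i},\dots,u_n)x_i.\end{aligned}$$ If it is an $n$-Lie bracket, the resulting $n$-Lie algebra is the crossed product $\mathfrak g\#_{\rh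o_V,\vartheta_V,\omega}V$.
   Formalization: For n=2 the displayed operation counts the mixed terms twice (ϑ_V=ρ_V), so Φ is not a homomorphism in general; the isomorphism is instead stated for n=2 with ρ_V replaced by 0, and also with ϑ_V replaced by 0. For n≥3, and in the converse for all n≥2, it is as stated. *)

theory Defs
  imports "HOL-Analysis.Product_Vector"
begin

text \<open>
  A vector space over a field \<open>'k\<close> of characteristic zero is a type with a scalar multiplication
  (locale \<^locale>\<open>vector_space\<close>). A map of \<open>n\<close> arguments is a function on lists of which only
  the values on lists of length \<open>n\<close> are meaningful; list positions are counted from 0.
\<close>

definition multilinear ::
  "nat \<Rightarrow> ('k::field \<Rightarrow> 'a::ab_group_add \<Rightarrow> 'a) \<Rightarrow> ('k \<Rightarrow> 'b::ab_group_add \<Rightarrow> 'b) \<Rightarrow>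
    ('a list \<Rightarrow> 'b) \<Rightarrow> bool"
  where "multilinear n sa sb f \<longleftrightarrow>
    (\<forall>xs j. length xs = n \<and> j < n \<longrightarrow> Vector_Spaces.linear sa sb (\<lambda>x. f (xs[j := x])))"

text \<open>Linear maps out of the \<open>n\<close>-th exterior power are represented by alternating \<open>n\<close>-linear maps.\<close>

definition alternating_map ::
  "nat \<Rightarrow> ('k::field \<Rightarrow> 'a::ab_group_add \<Rightarrow> 'a) \<Rightarrow> ('k \<Rightarrow> 'b::ab_group_add \<Rightarrow> 'b) \<Rightarrow>
    ('a list \<Rightarrow> 'b) \<Rightarrow> bool"
  where "alternating_map n sa sb f \<longleftrightarrow>
    multilinear n sa sb f \<and> (\<forall>xs. length xs = n \<and> \<not> distinct xs \<longrightarrow> f xs = 0)"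

locale n_lie_algebra = vector_space scale
  for scale :: "'k::field_char_0 \<Rightarrow> 'a::ab_group_add \<Rightarrow> 'a" +
  fixes n :: nat and bracket :: "'a list \<Rightarrow> 'a"
  assumes alternating: "alternating_map n scale scale bracket"
    and fundamental_identity:
      "\<lbrakk>length zs = n - 1; length ws = n\<rbrakk> \<Longrightarrow>
        bracket (zs @ [bracket ws]) = (\<Sum>j<n. bracket (ws[j := bracket (zs @ [ws ! j])]))"

definition n_lie_hom ::
  "nat \<Rightarrow> ('k::field_char_0 \<Rightarrow> 'a::ab_group_add \<Rightarrow> 'a) \<Rightarrow> ('a list \<Rightarrow> 'a) \<Rightarrow>
    ('k \<Rightarrow> 'b::ab_group_add \<Rightarrow> 'b) \<Rightarrow> ('b list \<Rightarrow> 'b) \<Rightarrow> ('a \<Rightarrow> 'b) \<Rightarrow> bool"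
  where "n_lie_hom n sa ba sb bb f \<longleftrightarrow>
    n_lie_algebra sa n ba \<and> n_lie_algebra sb n bb \<and> Vector_Spaces.linear sa sb f \<and>
    (\<forall>xs. length xs = n \<longrightarrow> f (ba xs) = bb (map f xs))"

definition n_lie_iso ::
  "nat \<Rightarrow> ('k::field_char_0 \<Rightarrow> 'a::ab_group_add \<Rightarrow> 'a) \<Rightarrow> ('a list \<Rightarrow> 'a) \<Rightarrow>
    ('k \<Rightarrow> 'b::ab_group_add \<Rightarrow> 'b) \<Rightarrow> ('b list \<Rightarrow> 'b) \<Rightarrow> ('a \<Rightarrow> 'b) \<Rightarrow> bool"
  where "n_lie_iso n sa ba sb bb f \<longleftrightarrow> n_lie_hom n sa ba sb bb f \<and> bij f"

text \<open>A (non-abelian) extension of \<open>V\<close> by \<open>g\<close>: the sequence \<open>0 \<rightarrow> g \<rightarrow> E \<rightarrow> V \<rightarrow> 0\<close> is exact.\<close>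

definition n_lie_extension ::
  "nat \<Rightarrow> ('k::field_char_0 \<Rightarrow> 'g::ab_group_add \<Rightarrow> 'g) \<Rightarrow> ('g list \<Rightarrow> 'g) \<Rightarrow>
    ('k \<Rightarrow> 'e::ab_group_add \<Rightarrow> 'e) \<Rightarrow> ('e list \<Rightarrow> 'e) \<Rightarrow>
    ('k \<Rightarrow> 'v::ab_group_add \<Rightarrow> 'v) \<Rightarrow> ('v list \<Rightarrow> 'v) \<Rightarrow> ('g \<Rightarrow> 'e) \<Rightarrow> ('e \<Rightarrow> 'v) \<Rightarrow> bool"
  where "n_lie_extension n sg bg se be sv bv i p \<longleftrightarrow>
    n_lie_hom n sg bg se be i \<and> n_lie_hom n se be sv bv p \<and>
    inj i \<and> range i = {e. p e = 0} \<and> surj p"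

definition linear_section ::
  "('k::field \<Rightarrow> 'e::ab_group_add \<Rightarrow> 'e) \<Rightarrow> ('k \<Rightarrow> 'v::ab_group_add \<Rightarrow> 'v) \<Rightarrow>
    ('e \<Rightarrow> 'v) \<Rightarrow> ('v \<Rightarrow> 'e) \<Rightarrow> bool"
  where "linear_section se sv p \<sigma> \<longleftrightarrow> Vector_Spaces.linear sv se \<sigma> \<and> p \<circ> \<sigma> = id"

definition sparse ::
  "nat \<Rightarrow> ('e::ab_group_add list \<Rightarrow> 'e) \<Rightarrow> ('g \<Rightarrow> 'e) \<Rightarrow> ('v \<Rightarrow> 'e) \<Rightarrow> bool"
  where "sparse n be i \<sigma> \<longleftrightarrow>
    (\<forall>k us xs. 2 \<le> k \<and> k + 2 \<le> n \<and> length us = k \<and> length xs = n - k \<longrightarrow>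
      be (map \<sigma> us @ map i xs) = 0)"

definition omit :: "nat \<Rightarrow> 'a list \<Rightarrow> 'a list"
  where "omit j xs = take j xs @ drop (Suc j) xs"

definition crossed_maps ::
  "nat \<Rightarrow> ('k::field_char_0 \<Rightarrow> 'g::ab_group_add \<Rightarrow> 'g) \<Rightarrow> ('k \<Rightarrow> 'v::ab_group_add \<Rightarrow> 'v) \<Rightarrow>
    ('v list \<Rightarrow> 'g \<Rightarrow> 'g) \<Rightarrow> ('v \<Rightarrow> 'g list \<Rightarrow> 'g) \<Rightarrow> ('v list \<Rightarrow> 'g) \<Rightarrow> bool"
  where "crossed_maps n sg sv \<rho> \<theta> \<omega> \<longleftrightarrow>
    (\<forall>us. length us = n - 1 \<longrightarrow> Vector_Spaces.linear sg sg (\<rho> us)) \<and>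
    (\<forall>x. alternating_map (n - 1) sv sg (\<lambda>us. \<rho> us x)) \<and>
    (\<forall>u. alternating_map (n - 1) sg sg (\<theta> u)) \<and>
    (\<forall>xs. length xs = n - 1 \<longrightarrow> Vector_Spaces.linear sv sg (\<lambda>u. \<theta> u xs)) \<and>
    alternating_map n sv sg \<omega>"

text \<open>The element \<open>x + u\<close> of the direct sum is the pair \<open>(x, u)\<close>. As positions are counted from 0,
  the exponents \<open>i - 1\<close> and \<open>n - i\<close> of the usual formula become \<open>j\<close> and \<open>n - 1 - j\<close>.\<close>

definition crossed_bracket ::
  "nat \<Rightarrow> ('k::field_char_0 \<Rightarrow> 'g::ab_group_add \<Rightarrow> 'g) \<Rightarrow> ('g list \<Rightarrow> 'g) \<Rightarrow>
    ('v::ab_group_add list \<Rightarrow> 'v) \<Rightarrow>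
    ('v list \<Rightarrow> 'g \<Rightarrow> 'g) \<Rightarrow> ('v \<Rightarrow> 'g list \<Rightarrow> 'g) \<Rightarrow> ('v list \<Rightarrow> 'g) \<Rightarrow>
    ('g \<times> 'v) list \<Rightarrow> 'g \<times> 'v"
  where "crossed_bracket n sg bg bv \<rho> \<theta> \<omega> ps =
    (let xs = map fst ps; us = map snd ps in
      (bg xs + \<omega> us
        + (\<Sum>j<n. sg ((-1) ^ j) (\<theta> (us ! j) (omit j xs)))
        + (\<Sum>j<n. sg ((-1) ^ (n - 1 - j)) (\<rho> (omit j us) (xs ! j))),
       bv us))"

definition crossed_product ::
  "nat \<Rightarrow> ('k::field_char_0 \<Rightarrow> 'g::ab_group_add \<Rightarrow> 'g) \<Rightarrow> ('g list \<Rightarrow> 'g) \<Rightarrow>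
    ('k \<Rightarrow> 'v::ab_group_add \<Rightarrow> 'v) \<Rightarrow> ('v list \<Rightarrow> 'v) \<Rightarrow>
    ('v list \<Rightarrow> 'g \<Rightarrow> 'g) \<Rightarrow> ('v \<Rightarrow> 'g list \<Rightarrow> 'g) \<Rightarrow> ('v list \<Rightarrow> 'g) \<Rightarrow> bool"
  where "crossed_product n sg bg sv bv \<rho> \<theta> \<omega> \<longleftrightarrow>
    n_lie_algebra sg n bg \<and> n_lie_algebra sv n bv \<and> crossed_maps n sg sv \<rho> \<theta> \<omega> \<and>
    n_lie_algebra (module_prod.scale sg sv) n (crossed_bracket n sg bg bv \<rho> \<theta> \<omega>)"

text \<open>The maps attached to a section. Their values are elements of \<open>g\<close>, so they are the preimages
  under the injection \<open>i\<close> of the corresponding elements of \<open>E\<close> (which have to be shown to lie in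
  \<open>range i\<close>).\<close>

definition section_theta ::
  "('e list \<Rightarrow> 'e) \<Rightarrow> ('g \<Rightarrow> 'e) \<Rightarrow> ('v \<Rightarrow> 'e) \<Rightarrow> 'v \<Rightarrow> 'g list \<Rightarrow> 'g"
  where "section_theta be i \<sigma> u xs = inv i (be (\<sigma> u # map i xs))"

definition section_rho ::
  "('e list \<Rightarrow> 'e) \<Rightarrow> ('g \<Rightarrow> 'e) \<Rightarrow> ('v \<Rightarrow> 'e) \<Rightarrow> 'v list \<Rightarrow> 'g \<Rightarrow> 'g"
  where "section_rho be i \<sigma> us x = inv i (be (map \<sigma> us @ [i x]))"

definition section_omega ::
  "('e::ab_group_add list \<Rightarrow> 'e) \<Rightarrow> ('v list \<Rightarrow> 'v) \<Rightarrow> ('g \<Rightarrow> 'e) \<Rightarrow> ('v \<Rightarrow> 'e) \<Rightarrow> 'v list \<Rightarrow> 'g"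
  where "section_omega be bv i \<sigma> us = inv i (be (map \<sigma> us) - \<sigma> (bv us))"

definition section_iso :: "('g \<Rightarrow> 'e::ab_group_add) \<Rightarrow> ('v \<Rightarrow> 'e) \<Rightarrow> 'g \<times> 'v \<Rightarrow> 'e"
  where "section_iso i \<sigma> = (\<lambda>(x, u). i x + \<sigma> u)"

text \<open>
  Pitfall: for \<open>n = 2\<close> the maps \<open>\<theta>\<close> and \<open>\<rho>\<close> attached to a section agree, since both record
  the brackets with exactly one argument from \<open>V\<close>. The two sums in \<open>crossed_bracket\<close> then count
  these brackets twice, and \<open>section_iso\<close> is in general not a homomorphism on the crossed product
  of all three maps. For \<open>n = 2\<close> one of \<open>\<theta>\<close> and \<open>\<rho>\<close> has to be replaced by \<open>zero_map\<close>.
\<close>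

definition zero_map :: "'a \<Rightarrow> 'b \<Rightarrow> 'c::zero"
  where "zero_map a b = 0"

end

theory Submission
  imports Defs
begin

text \<open>
  The element \<open>(x, u)\<close> of \<open>g \<oplus> V\<close> is sent to \<open>\<Phi> (x, u) = i x + \<sigma> u\<close>, so a bracket of \<open>n\<close> elements
  of the form \<open>\<Phi> (x, u)\<close> expands by multilinearity into \<open>2 ^ n\<close> brackets, one for each set
  \<open>S \<subseteq> {..<n}\<close> of positions at which the summand from \<open>V\<close> is chosen
  (\<open>expand_over_subsets\<close>). Since the bracket is alternating, the entries of such a term can be
  reordered at the cost of a sign, with all the entries from \<open>V\<close> in front; sparsity then says
  that the term is zero whenever \<open>2 \<le> card S \<le> n - 2\<close> (\<open>mixed_bracket_vanishes\<close>). What survives is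
  exactly the crossed-product operation: \<open>S = {}\<close> gives the bracket of \<open>g\<close>, \<open>S = {j}\<close> gives a
  value of \<open>\<theta>\<close> with the sign \<open>(-1) ^ j\<close> of moving position \<open>j\<close> to the front, the complement of
  \<open>{j}\<close> gives a value of \<open>\<rho>\<close> with the sign \<open>(-1) ^ (n - 1 - j)\<close> of moving position \<open>j\<close> to the
  end, and \<open>S = {..<n}\<close> gives \<open>\<omega>\<close> plus \<open>\<sigma>\<close> of the bracket of \<open>V\<close>. For \<open>n \<ge> 3\<close> these sets are
  pairwise different. For \<open>n = 2\<close> the singletons are the complements of singletons, so that the
  same terms can be written with \<open>\<theta>\<close> alone or with \<open>\<rho>\<close> alone.

  Thus \<open>\<Phi>\<close> is a linear bijection that intertwines the crossed-product operation with the bracket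
  of \<open>E\<close>. The alternating property and the fundamental identity therefore need not be computed on
  the crossed product: they are pulled back from \<open>E\<close> along \<open>\<Phi>\<close> (\<open>n_lie_algebra_transport\<close>).

  Conversely, in a crossed product a bracket of \<open>k\<close> elements \<open>(0, u)\<close> and \<open>n - k\<close> elements
  \<open>(x, 0)\<close>, where \<open>2 \<le> k \<le> n - 2\<close>, has at least two zeros among its components in \<open>g\<close> and at
  least two among those in \<open>V\<close>. Omitting one position leaves a zero in both, which makes every term
  of the operation vanish.
\<close>

section \<open>Alternating multilinear maps\<close>

lemma linear_in_slot:
  assumes "alternating_map n sa sb f" and "length as + Suc (length bs) = n"
  shows "Vector_Spaces.linear sa sb (\<lambda>x. f (as @ x # bs))"
proof -
  have "Vector_Spaces.linear sa sb (\<lambda>x. f ((as @ undefined # bs)[length as := x]))"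
    using assms unfolding alternating_map_def multilinear_def
    by (auto dest!: spec[of _ "as @ undefined # bs"] spec[of _ "length as"])
  then show ?thesis by simp
qed

lemma add_in_slot:
  assumes "alternating_map n sa sb f" and "length as + Suc (length bs) = n"
  shows "f (as @ (a + b) # bs) = f (as @ a # bs) + f (as @ b # bs)"
  using linear_in_slot[OF assms] unfolding Vector_Spaces.linear_iff by blast

lemma alternating_map_zero:
  assumes "alternating_map n sa sb f" and "length xs = n" and "0 \<in> set xs"
  shows "f xs = 0"
proof -
  obtain as bs where xs: "xs = as @ 0 # bs"
    using split_list[OF assms(3)] by blast
  have "f (as @ (0 + 0) # bs) = f (as @ 0 # bs) + f (as @ 0 # bs)"
    by (rule add_in_slot[OF assms(1)]) (use assms(2) xs in simp)
  then show ?thesis by (simp add: xs)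
qed

lemma alternating_map_not_distinct:
  "\<lbrakk>alternating_map n sa sb f; length xs = n; \<not> distinct xs\<rbrakk> \<Longrightarrow> f xs = 0"
  by (simp add: alternating_map_def)

text \<open>Polarisation: the value at a list with the entry \<open>a + b\<close> in both slots is zero.\<close>
lemma swap_adjacent:
  assumes f: "alternating_map n sa sb f" and len: "length as + Suc (Suc (length bs)) = n"
  shows "f (as @ a # b # bs) = - f (as @ b # a # bs)"
proof -
  have slot1: "f (as @ (x + y) # z # bs) = f (as @ x # z # bs) + f (as @ y # z # bs)" for x y z
    by (rule add_in_slot[OF f]) (use len in simp)
  have slot2: "f (as @ z # (x + y) # bs) = f (as @ z # x # bs) + f (as @ z # y # bs)" for x y z
    using add_in_slot[OF f, of "as @ [z]" bs x y] len by simp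
  have same: "f (as @ x # x # bs) = 0" for x
    by (rule alternating_map_not_distinct[OF f]) (use len in auto)
  have "0 = f (as @ (a + b) # (a + b) # bs)" by (rule same[symmetric])
  also have "\<dots> = f (as @ a # b # bs) + f (as @ b # a # bs)"
    by (simp only: slot1 slot2) (simp add: same)
  finally have "f (as @ a # b # bs) + f (as @ b # a # bs) = 0" by (rule sym)
  then show ?thesis by (simp add: eq_neg_iff_add_eq_0)
qed

text \<open>
  Choosing \<open>cs\<close> or \<open>bs\<close> empty moves an entry to the front or, read from right to left, to the end;
  these two instances produce the signs of the crossed-product operation.
\<close>
lemma move_entry:
  assumes f: "alternating_map n sa sb f" and "length cs + length as + Suc (length bs) = n"
  shows "f (cs @ as @ y # bs) = sb ((-1) ^ length as) (f (cs @ y # as @ bs))"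
  using assms(2)
proof (induction as arbitrary: bs rule: rev_induct)
  case Nil
  then have "vector_space sb"
    using linear_in_slot[OF f, of cs bs] by (simp add: Vector_Spaces.linear_iff)
  then interpret vector_space sb .
  show ?case by simp
next
  case (snoc a as)
  then have "vector_space sb"
    using linear_in_slot[OF f, of "cs @ as" "y # bs"] by (simp add: Vector_Spaces.linear_iff)
  then interpret vector_space sb .
  have "f ((cs @ as) @ a # y # bs) = - f ((cs @ as) @ y # a # bs)"
    by (rule swap_adjacent[OF f]) (use snoc.prems in simp)
  also have "\<dots> = - sb ((-1) ^ length as) (f (cs @ y # as @ a # bs))"
    using snoc.IH[of "a # bs"] snoc.prems by simp
  finally show ?case by simp
qed

text \<open>
  Collecting the entries with property \<open>P\<close> in front changes the value only by a sign, so vanishing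
  can be tested after this rearrangement. The property is one of the labels \<open>k\<close> rather than of the
  entries \<open>c k\<close>, because the same vector may occur under labels of both kinds. The prefix \<open>pre\<close>
  collects the entries already dealt with in the induction.
\<close>
lemma vanishing_from_sorted:
  assumes f: "alternating_map n sa sb f" and "length pre + length ks = n"
    and "f (pre @ map c (filter P ks) @ map c (filter (\<lambda>k. \<not> P k) ks)) = 0"
  shows "f (pre @ map c ks) = 0"
  using assms(2,3)
proof (induction ks arbitrary: pre)
  case Nil
  then show ?case by simp
next
  case (Cons k ks)
  have len: "length (filter P ks) + length (filter (\<lambda>k. \<not> P k) ks) = length ks"
    by (rule sum_length_filter_compl)
  show ?case
  proof (cases "P k")
    case True
    then show ?thesis using Cons.IH[of "pre @ [c k]"] Cons.prems by simp
  next
    case False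
    let ?A = "map c (filter P ks)" and ?B = "map c (filter (\<lambda>k. \<not> P k) ks)"
    have "vector_space sb"
      using linear_in_slot[OF f, of pre "map c ks"] Cons.prems(1) by (simp add: Vector_Spaces.linear_iff)
    then interpret vector_space sb .
    have "f (pre @ ?A @ c k # ?B) = sb ((-1) ^ length ?A) (f (pre @ c k # ?A @ ?B))"
      by (rule move_entry[OF f]) (use Cons.prems(1) len in simp)
    then have "f (pre @ c k # ?A @ ?B) = 0"
      using Cons.prems(2) False by simp
    then show ?thesis
      using Cons.IH[of "pre @ [c k]"] Cons.prems(1) by simp
  qed
qed

lemma sum_over_Pow_Suc:
  "(\<Sum>S\<in>Pow {..<Suc m}. F S) = (\<Sum>S\<in>Pow {..<m}. F (insert m S)) + (\<Sum>S\<in>Pow {..<m}. F S)"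
proof -
  have inj: "inj_on (insert m) (Pow {..<m})"
    by (auto simp: inj_on_def)
  have "Pow {..<m} \<inter> insert m ` Pow {..<m} = {}" by auto
  then have "(\<Sum>S\<in>Pow {..<Suc m}. F S)
      = (\<Sum>S\<in>Pow {..<m}. F S) + (\<Sum>S\<in>insert m ` Pow {..<m}. F S)"
    by (simp add: lessThan_Suc Pow_insert sum.union_disjoint)
  then show ?thesis
    by (simp add: sum.reindex[OF inj] add.commute)
qed

text \<open>
  The set \<open>S\<close> records the positions where the first summand is chosen. The tail \<open>ys\<close> holds the
  entries that the induction on \<open>m\<close> has already expanded.
\<close>
lemma expand_over_subsets:
  assumes f: "alternating_map n sa sb f" and "m + length ys = n"
  shows "f (map (\<lambda>k. a k + b k) [0..<m] @ ys)
    = (\<Sum>S\<in>Pow {..<m}. f (map (\<lambda>k. if k \<in> S then a k else b k) [0..<m] @ ys))"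
  using assms(2)
proof (induction m arbitrary: ys)
  case 0
  then show ?case by simp
next
  case (Suc m)
  let ?c = "\<lambda>S k. if k \<in> S then a k else b k"
  have "f (map (\<lambda>k. a k + b k) [0..<Suc m] @ ys)
      = f (map (\<lambda>k. a k + b k) [0..<m] @ (a m + b m) # ys)" by simp
  also have "\<dots> = f (map (\<lambda>k. a k + b k) [0..<m] @ a m # ys)
      + f (map (\<lambda>k. a k + b k) [0..<m] @ b m # ys)"
    by (rule add_in_slot[OF f]) (use Suc.prems in simp)
  also have "\<dots> = (\<Sum>S\<in>Pow {..<m}. f (map (?c S) [0..<m] @ a m # ys))
      + (\<Sum>S\<in>Pow {..<m}. f (map (?c S) [0..<m] @ b m # ys))"
    using Suc.IH[of "a m # ys"] Suc.IH[of "b m # ys"] Suc.prems by simp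
  also have "(\<Sum>S\<in>Pow {..<m}. f (map (?c S) [0..<m] @ a m # ys))
      = (\<Sum>S\<in>Pow {..<m}. f (map (?c (insert m S)) [0..<Suc m] @ ys))"
    by (intro sum.cong refl arg_cong[of _ _ f]) auto
  also have "(\<Sum>S\<in>Pow {..<m}. f (map (?c S) [0..<m] @ b m # ys))
      = (\<Sum>S\<in>Pow {..<m}. f (map (?c S) [0..<Suc m] @ ys))"
    by (intro sum.cong refl arg_cong[of _ _ f]) auto
  finally show ?case by (simp only: sum_over_Pow_Suc)
qed

lemma alternating_map_precompose:
  fixes sc :: "'k::field \<Rightarrow> 'c::ab_group_add \<Rightarrow> 'c"
  assumes f: "alternating_map n sa sb f" and h: "Vector_Spaces.linear sc sa h"
    and len: "length as + m + length bs = n"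
  shows "alternating_map m sc sb (\<lambda>xs. f (as @ map h xs @ bs))"
  unfolding alternating_map_def multilinear_def
proof (intro conjI allI impI)
  fix xs :: "'c list" and j assume "length xs = m \<and> j < m"
  then have "Vector_Spaces.linear sa sb
      (\<lambda>x. f ((as @ map h (take j xs)) @ x # (map h (drop (Suc j) xs) @ bs)))"
    by (intro linear_in_slot[OF f]) (use len in simp)
  from Vector_Spaces.linear_compose[OF h this] \<open>length xs = m \<and> j < m\<close>
  show "Vector_Spaces.linear sc sb (\<lambda>x. f (as @ map h (xs[j := x]) @ bs))"
    by (simp add: o_def upd_conv_take_nth_drop)
next
  fix xs :: "'c list" assume "length xs = m \<and> \<not> distinct xs"
  then show "f (as @ map h xs @ bs) = 0"
    by (intro alternating_map_not_distinct[OF f]) (use len in \<open>auto simp: distinct_map\<close>)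
qed

lemma alternating_map_diff_postcompose:
  fixes sa :: "'k::field \<Rightarrow> 'a::ab_group_add \<Rightarrow> 'a"
  assumes f: "alternating_map n sa sb f" and g: "alternating_map n sa sc g"
    and h: "Vector_Spaces.linear sc sb h"
  shows "alternating_map n sa sb (\<lambda>xs. f xs - h (g xs))"
  unfolding alternating_map_def multilinear_def
proof (intro conjI allI impI)
  fix xs :: "'a list" and j assume *: "length xs = n \<and> j < n"
  then have lf: "Vector_Spaces.linear sa sb (\<lambda>x. f (xs[j := x]))"
    and lg: "Vector_Spaces.linear sa sc (\<lambda>x. g (xs[j := x]))"
    using f g unfolding alternating_map_def multilinear_def by auto
  then interpret vector_space sb by (simp add: Vector_Spaces.linear_iff)
  show "Vector_Spaces.linear sa sb (\<lambda>x. f (xs[j := x]) - h (g (xs[j := x])))"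
    using lf lg h unfolding Vector_Spaces.linear_iff by (simp add: scale_right_diff_distrib)
next
  fix xs :: "'a list" assume "length xs = n \<and> \<not> distinct xs"
  moreover have "h 0 = 0"
    using h unfolding Vector_Spaces.linear_iff by (metis add_cancel_right_right)
  ultimately show "f xs - h (g xs) = 0"
    using f g unfolding alternating_map_def by simp
qed

lemma linear_inv_postcompose:
  assumes f: "Vector_Spaces.linear sa sb f" and i: "Vector_Spaces.linear sc sb i" "inj i"
    and range: "\<And>x. f x \<in> range i"
  shows "Vector_Spaces.linear sa sc (\<lambda>x. inv i (f x))"
  unfolding Vector_Spaces.linear_iff
proof (intro conjI allI)
  have i_inv: "i (inv i (f x)) = f x" for x
    by (rule f_inv_into_f[OF range])
  have i_add: "i (a + b) = i a + i b" and i_scale: "i (sc c a) = sb c (i a)" for a b c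
    using i(1) by (simp_all add: Vector_Spaces.linear_iff)
  have f_add: "f (x + y) = f x + f y" and f_scale: "f (sa c x) = sb c (f x)" for x y c
    using f by (simp_all add: Vector_Spaces.linear_iff)
  show "inv i (f (x + y)) = inv i (f x) + inv i (f y)" for x y
    by (rule injD[OF i(2)], simp only: i_add i_inv, rule f_add)
  show "inv i (f (sa c x)) = sc c (inv i (f x))" for c x
    by (rule injD[OF i(2)], simp only: i_scale i_inv, rule f_scale)
qed (use f i(1) in \<open>simp_all add: Vector_Spaces.linear_iff\<close>)

lemma alternating_map_inv_postcompose:
  fixes sa :: "'k::field \<Rightarrow> 'a::ab_group_add \<Rightarrow> 'a"
  assumes f: "alternating_map m sa sb f" and i: "Vector_Spaces.linear sc sb i" "inj i"
    and range: "\<And>xs. length xs = m \<Longrightarrow> f xs \<in> range i"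
  shows "alternating_map m sa sc (\<lambda>xs. inv i (f xs))"
  unfolding alternating_map_def multilinear_def
proof (intro conjI allI impI)
  fix xs :: "'a list" and j assume "length xs = m \<and> j < m"
  then show "Vector_Spaces.linear sa sc (\<lambda>x. inv i (f (xs[j := x])))"
    using f by (intro linear_inv_postcompose[OF _ i] range)
      (auto simp: alternating_map_def multilinear_def)
next
  fix xs :: "'a list" assume "length xs = m \<and> \<not> distinct xs"
  then have "f xs = 0"
    using alternating_map_not_distinct[OF f] by blast
  moreover have "i 0 = 0"
    using i(1) unfolding Vector_Spaces.linear_iff by (metis add_cancel_right_right)
  ultimately show "inv i (f xs) = 0"
    using inv_f_f[OF i(2), of 0] by simp
qed

section \<open>Transport of structure and sums over subsets\<close>

text \<open>
  As \<open>\<Phi>\<close> is injective, each axiom for \<open>bp\<close> can be checked after applying \<open>\<Phi>\<close>, where it becomes the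
  same axiom for \<open>be\<close>. The bracket \<open>bp\<close> is \<open>be\<close> conjugated by \<open>\<Phi>\<close>, hence alternating.
\<close>
lemma n_lie_algebra_transport:
  assumes E: "n_lie_algebra se n be" and \<Phi>: "Vector_Spaces.linear sp se \<Phi>" "bij \<Phi>"
    and hom: "\<And>ps. length ps = n \<Longrightarrow> \<Phi> (bp ps) = be (map \<Phi> ps)"
    and "n \<ge> 1"
  shows "n_lie_algebra sp n bp"
proof -
  interpret E: n_lie_algebra se n be by fact
  have "vector_space sp" using \<Phi>(1) by (simp add: Vector_Spaces.linear_iff)
  then interpret P: vector_space sp .
  have inj: "\<Phi> x = \<Phi> y \<Longrightarrow> x = y" for x y
    using \<Phi>(2) by (simp add: bij_def inj_eq)
  have "alternating_map n sp se (\<lambda>ps. be ([] @ map \<Phi> ps @ []))"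
    by (rule alternating_map_precompose[OF E.alternating \<Phi>(1)]) simp
  then have "alternating_map n sp sp (\<lambda>ps. inv \<Phi> (be ([] @ map \<Phi> ps @ [])))"
    by (rule alternating_map_inv_postcompose[OF _ \<Phi>(1)])
      (use \<Phi>(2) in \<open>auto simp: bij_def surj_def\<close>)
  moreover have "bp ps = inv \<Phi> (be ([] @ map \<Phi> ps @ []))" if "length ps = n" for ps
    by (simp add: bij_inv_eq_iff[OF \<Phi>(2)] hom that)
  ultimately have alt: "alternating_map n sp sp bp"
    unfolding alternating_map_def multilinear_def by auto
  have "bp (zs @ [bp ws]) = (\<Sum>j<n. bp (ws[j := bp (zs @ [ws ! j])]))"
    if len: "length zs = n - 1" "length ws = n" for zs ws
  proof (rule inj)
    interpret \<Phi>: Vector_Spaces.linear sp se \<Phi> by fact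
    have "\<Phi> (bp (zs @ [bp ws])) = be (map \<Phi> zs @ [be (map \<Phi> ws)])"
      using hom len \<open>n \<ge> 1\<close> by simp
    also have "\<dots> = (\<Sum>j<n. be ((map \<Phi> ws)[j := be (map \<Phi> zs @ [map \<Phi> ws ! j])]))"
      by (rule E.fundamental_identity) (use len in simp_all)
    also have "\<dots> = (\<Sum>j<n. \<Phi> (bp (ws[j := bp (zs @ [ws ! j])])))"
      using hom len \<open>n \<ge> 1\<close> by (intro sum.cong) (simp_all add: map_update)
    finally show "\<Phi> (bp (zs @ [bp ws])) = \<Phi> (\<Sum>j<n. bp (ws[j := bp (zs @ [ws ! j])]))"
      by (simp add: \<Phi>.sum)
  qed
  with alt show ?thesis
    by unfold_locales
qed

text \<open>
  The remaining subsets have cardinality \<open>0\<close>, \<open>1\<close>, \<open>n - 1\<close> or \<open>n\<close>. These numbers are pairwise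
  different precisely when \<open>n \<ge> 3\<close>, which is where the binary case separates from the others.
\<close>
lemma sum_over_small_and_cosmall_subsets:
  fixes F :: "nat set \<Rightarrow> 'a::ab_group_add"
  assumes "n \<ge> 3"
    and zero: "\<And>S. \<lbrakk>S \<subseteq> {..<n}; 2 \<le> card S; card S + 2 \<le> n\<rbrakk> \<Longrightarrow> F S = 0"
  shows "(\<Sum>S\<in>Pow {..<n}. F S)
    = F {} + F {..<n} + (\<Sum>j<n. F {j}) + (\<Sum>j<n. F ({..<n} - {j}))"
proof -
  let ?N = "{..<n}"
  let ?A = "{{}, ?N}" and ?B = "(\<lambda>j. {j}) ` ?N" and ?C = "(\<lambda>j. ?N - {j}) ` ?N"
  have cardC: "card S = n - 1" if "S \<in> ?C" for S using that by auto
  have cardB: "card S = 1" if "S \<in> ?B" for S using that by auto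
  have cardA: "card S = 0 \<or> card S = n" if "S \<in> ?A" for S using that by auto
  have other: "F S = 0" if "S \<in> Pow ?N - (?A \<union> ?B \<union> ?C)" for S
  proof (rule zero)
    show "S \<subseteq> ?N" using that by blast
    then have fin: "finite S" by (rule finite_subset) simp
    have "card S \<noteq> 0" using that fin by auto
    moreover have "card S \<noteq> 1" using that by (auto simp: card_1_singleton_iff)
    ultimately show "2 \<le> card S" by simp
    have card: "card (?N - S) + card S = n"
      using card_Diff_subset[OF fin \<open>S \<subseteq> ?N\<close>] card_mono[OF _ \<open>S \<subseteq> ?N\<close>] by simp
    have "card (?N - S) \<noteq> 0"
      using that by auto
    moreover have "card (?N - S) \<noteq> 1"
    proof
      assume "card (?N - S) = 1"
      then obtain j where "?N - S = {j}" by (auto simp: card_1_singleton_iff)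
      then have "S = ?N - {j}" "j \<in> ?N" using \<open>S \<subseteq> ?N\<close> by blast+
      then show False using that by blast
    qed
    ultimately show "card S + 2 \<le> n" using card by linarith
  qed
  have "(\<Sum>S\<in>Pow ?N. F S) = (\<Sum>S\<in>?A \<union> ?B \<union> ?C. F S)"
    by (rule sum.mono_neutral_right) (use other in auto)
  also have "\<dots> = (\<Sum>S\<in>?A. F S) + (\<Sum>S\<in>?B. F S) + (\<Sum>S\<in>?C. F S)"
  proof -
    have "S \<notin> ?B" if "S \<in> ?A" for S
      using cardA[OF that] cardB[of S] \<open>n \<ge> 3\<close> by linarith
    moreover have "S \<notin> ?C" if "S \<in> ?A \<union> ?B" for S
      using that cardA[of S] cardB[of S] cardC[of S] \<open>n \<ge> 3\<close> by (elim UnE) linarith+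
    ultimately have "?A \<inter> ?B = {}" "(?A \<union> ?B) \<inter> ?C = {}"
      by blast+
    then show ?thesis
      by (subst sum.union_disjoint, (simp; fail)+)+
  qed
  also have "(\<Sum>S\<in>?A. F S) = F {} + F ?N"
  proof -
    have "0 \<in> ?N" using \<open>n \<ge> 3\<close> by simp
    then have "{} \<noteq> ?N" by blast
    then show ?thesis by simp
  qed
  also have "(\<Sum>S\<in>?B. F S) = (\<Sum>j<n. F {j})"
    by (subst sum.reindex) (auto simp: inj_on_def)
  also have "(\<Sum>S\<in>?C. F S) = (\<Sum>j<n. F (?N - {j}))"
    by (subst sum.reindex) (auto simp: inj_on_def)
  finally show ?thesis .
qed

lemma sum_over_subsets_of_two:
  fixes F :: "nat set \<Rightarrow> 'a::ab_group_add"
  shows "(\<Sum>S\<in>Pow {..<2}. F S) = F {} + F {..<2} + (\<Sum>j<2. F {j})"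
proof -
  have "{..<2::nat} = {0, 1}" by auto
  then show ?thesis by (simp add: Pow_insert image_Un insert_commute algebra_simps)
qed

section \<open>The crossed product attached to a section\<close>

lemma crossed_maps_zero_rho:
  assumes "crossed_maps n sg sv \<rho> \<theta> \<omega>" and sg: "vector_space sg" and sv: "vector_space sv"
  shows "crossed_maps n sg sv zero_map \<theta> \<omega>"
proof -
  interpret G: vector_space sg by fact
  show ?thesis
    using assms unfolding crossed_maps_def alternating_map_def multilinear_def
    by (simp add: zero_map_def Vector_Spaces.linear_iff)
qed

lemma crossed_maps_zero_theta:
  assumes "crossed_maps n sg sv \<rho> \<theta> \<omega>" and sg: "vector_space sg" and sv: "vector_space sv"
  shows "crossed_maps n sg sv \<rho> zero_map \<omega>"
proof -
  interpret G: vector_space sg by fact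
  show ?thesis
    using assms unfolding crossed_maps_def alternating_map_def multilinear_def
    by (simp add: zero_map_def Vector_Spaces.linear_iff)
qed

locale sectioned_extension =
  fixes n :: nat
    and sg :: "'k::field_char_0 \<Rightarrow> 'g::ab_group_add \<Rightarrow> 'g" and bg :: "'g list \<Rightarrow> 'g"
    and se :: "'k \<Rightarrow> 'e::ab_group_add \<Rightarrow> 'e" and be :: "'e list \<Rightarrow> 'e"
    and sv :: "'k \<Rightarrow> 'v::ab_group_add \<Rightarrow> 'v" and bv :: "'v list \<Rightarrow> 'v"
    and i :: "'g \<Rightarrow> 'e" and p :: "'e \<Rightarrow> 'v" and \<sigma> :: "'v \<Rightarrow> 'e"
  assumes arity: "n \<ge> 2"
    and extension: "n_lie_extension n sg bg se be sv bv i p"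
    and linear_section: "linear_section se sv p \<sigma>"
begin

abbreviation "\<theta> \<equiv> section_theta be i \<sigma>"
abbreviation "\<rho> \<equiv> section_rho be i \<sigma>"
abbreviation "\<omega> \<equiv> section_omega be bv i \<sigma>"
abbreviation "\<Phi> \<equiv> section_iso i \<sigma>"

sublocale G: n_lie_algebra sg n bg
  using extension by (simp add: n_lie_extension_def n_lie_hom_def)

sublocale E: n_lie_algebra se n be
  using extension by (simp add: n_lie_extension_def n_lie_hom_def)

sublocale V: n_lie_algebra sv n bv
  using extension by (simp add: n_lie_extension_def n_lie_hom_def)

sublocale i: Vector_Spaces.linear sg se i
  using extension by (simp add: n_lie_extension_def n_lie_hom_def)

sublocale p: Vector_Spaces.linear se sv p
  using extension by (simp add: n_lie_extension_def n_lie_hom_def)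

sublocale \<sigma>: Vector_Spaces.linear sv se \<sigma>
  using linear_section by (simp add: linear_section_def)

sublocale P: vector_space_prod sg sv
  by (intro vector_space_prod.intro vector_space_pair.intro)
    (fact G.vector_space_axioms V.vector_space_axioms)+

lemma linear_i: "Vector_Spaces.linear sg se i"
  and linear_\<sigma>: "Vector_Spaces.linear sv se \<sigma>"
  by unfold_locales

lemma inj_i: "inj i"
  using extension by (simp add: n_lie_extension_def)

lemma range_i_iff: "e \<in> range i \<longleftrightarrow> p e = 0"
  using extension by (simp add: n_lie_extension_def)

lemma p_\<sigma> [simp]: "p (\<sigma> u) = u"
  using linear_section by (simp add: linear_section_def fun_eq_iff)

lemma p_i [simp]: "p (i x) = 0"
  using range_i_iff by blast

lemma i_bracket: "length xs = n \<Longrightarrow> i (bg xs) = be (map i xs)"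
  using extension by (simp add: n_lie_extension_def n_lie_hom_def)

lemma p_bracket: "length es = n \<Longrightarrow> p (be es) = bv (map p es)"
  using extension by (simp add: n_lie_extension_def n_lie_hom_def)

text \<open>The image of \<open>i\<close> is the kernel of the homomorphism \<open>p\<close>, hence an ideal of \<open>E\<close>.\<close>
lemma bracket_with_ideal_entry:
  assumes "length es = n" and "i x \<in> set es"
  shows "be es \<in> range i"
proof -
  have "0 \<in> p ` set es"
    using assms(2) p_i by (metis image_eqI)
  then have "bv (map p es) = 0"
    by (intro alternating_map_zero[OF V.alternating]) (simp_all add: assms(1))
  then show ?thesis
    by (simp add: range_i_iff p_bracket assms(1))
qed

lemma theta_in_range:
  assumes "length xs = n - 1"
  shows "be (\<sigma> u # map i xs) \<in> range i"
proof -
  \<comment> \<open>As \<open>n \<ge> 2\<close>, at least one entry of the bracket comes from the ideal.\<close>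
  have "xs \<noteq> []" using assms arity by auto
  then show ?thesis
    using assms arity by (intro bracket_with_ideal_entry[where x = "hd xs"]) auto
qed

lemma rho_in_range: "length us = n - 1 \<Longrightarrow> be (map \<sigma> us @ [i x]) \<in> range i"
  using arity by (intro bracket_with_ideal_entry[where x = x]) auto

lemma omega_in_range: "length us = n \<Longrightarrow> be (map \<sigma> us) - \<sigma> (bv us) \<in> range i"
  by (simp add: range_i_iff p.diff p_bracket o_def)

lemma i_theta: "length xs = n - 1 \<Longrightarrow> i (\<theta> u xs) = be (\<sigma> u # map i xs)"
  unfolding section_theta_def by (rule f_inv_into_f[OF theta_in_range])

lemma i_rho: "length us = n - 1 \<Longrightarrow> i (\<rho> us x) = be (map \<sigma> us @ [i x])"
  unfolding section_rho_def by (rule f_inv_into_f[OF rho_in_range])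

lemma i_omega: "length us = n \<Longrightarrow> i (\<omega> us) = be (map \<sigma> us) - \<sigma> (bv us)"
  unfolding section_omega_def by (rule f_inv_into_f[OF omega_in_range])

text \<open>
  The three maps are restrictions of the bracket of \<open>E\<close> along the linear maps \<open>\<sigma>\<close> and \<open>i\<close>, corrected
  by \<open>\<sigma>\<close> of the bracket of \<open>V\<close> in the case of \<open>\<omega>\<close>, and followed by the inverse of \<open>i\<close>; each of these
  operations preserves linearity and the alternating property.
\<close>
lemma crossed_maps_section: "crossed_maps n sg sv \<rho> \<theta> \<omega>"
proof -
  have "Vector_Spaces.linear sg sg (\<rho> us)" if "length us = n - 1" for us
  proof -
    have "Vector_Spaces.linear se se (\<lambda>e. be (map \<sigma> us @ e # []))"
      by (rule linear_in_slot[OF E.alternating]) (use that arity in simp)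
    from linear_inv_postcompose[OF Vector_Spaces.linear_compose[OF linear_i this] linear_i inj_i]
    show ?thesis
      using rho_in_range[OF that] unfolding section_rho_def by (simp add: o_def)
  qed
  moreover have "alternating_map (n - 1) sv sg (\<lambda>us. \<rho> us x)" for x
  proof -
    have "alternating_map (n - 1) sv se (\<lambda>us. be ([] @ map \<sigma> us @ [i x]))"
      by (rule alternating_map_precompose[OF E.alternating linear_\<sigma>]) (use arity in simp)
    then show ?thesis
      unfolding section_rho_def
      by (intro alternating_map_inv_postcompose[OF _ linear_i inj_i] rho_in_range) simp_all
  qed
  moreover have "alternating_map (n - 1) sg sg (\<theta> u)" for u
  proof -
    have "alternating_map (n - 1) sg se (\<lambda>xs. be ([\<sigma> u] @ map i xs @ []))"
      by (rule alternating_map_precompose[OF E.alternating linear_i]) (use arity in simp)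
    then have "alternating_map (n - 1) sg sg (\<lambda>xs. inv i (be (\<sigma> u # map i xs)))"
      by (intro alternating_map_inv_postcompose[OF _ linear_i inj_i] theta_in_range) simp_all
    then show ?thesis
      by (simp add: section_theta_def [abs_def])
  qed
  moreover have "Vector_Spaces.linear sv sg (\<lambda>u. \<theta> u xs)" if "length xs = n - 1" for xs
  proof -
    have "Vector_Spaces.linear se se (\<lambda>e. be ([] @ e # map i xs))"
      by (rule linear_in_slot[OF E.alternating]) (use that arity in simp)
    from linear_inv_postcompose[OF Vector_Spaces.linear_compose[OF linear_\<sigma> this] linear_i inj_i]
    show ?thesis
      using theta_in_range[OF that] unfolding section_theta_def by (simp add: o_def)
  qed
  moreover have "alternating_map n sv sg \<omega>"
  proof -
    have "alternating_map n sv se (\<lambda>us. be ([] @ map \<sigma> us @ []))"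
      by (rule alternating_map_precompose[OF E.alternating linear_\<sigma>]) simp
    then have "alternating_map n sv se (\<lambda>us. be (map \<sigma> us))" by simp
    from alternating_map_diff_postcompose[OF this V.alternating linear_\<sigma>]
    have "alternating_map n sv sg (\<lambda>us. inv i (be (map \<sigma> us) - \<sigma> (bv us)))"
      by (rule alternating_map_inv_postcompose[OF _ linear_i inj_i omega_in_range])
    then show ?thesis
      by (simp add: section_omega_def [abs_def])
  qed
  ultimately show ?thesis
    unfolding crossed_maps_def by blast
qed

lemma linear_section_iso: "Vector_Spaces.linear (module_prod.scale sg sv) se \<Phi>"
  unfolding Vector_Spaces.linear_iff
  using P.p.vector_space_axioms E.vector_space_axioms
  by (auto simp: section_iso_def P.scale_prod i.add i.scale \<sigma>.add \<sigma>.scale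
      E.scale_right_distrib algebra_simps)

text \<open>An element \<open>e\<close> has the unique decomposition \<open>e = (e - \<sigma> (p e)) + \<sigma> (p e)\<close>.\<close>
lemma bij_section_iso: "bij \<Phi>"
proof (rule bijI)
  show "inj \<Phi>"
  proof (rule injI)
    fix a b assume eq: "\<Phi> a = \<Phi> b"
    then have "p (\<Phi> a) = p (\<Phi> b)" by simp
    then have "snd a = snd b"
      by (simp add: section_iso_def case_prod_beta p.add)
    with eq show "a = b"
      using inj_i by (simp add: section_iso_def case_prod_beta prod_eq_iff inj_eq)
  qed
  show "surj \<Phi>"
  proof (rule surjI)
    fix e
    have "e - \<sigma> (p e) \<in> range i" by (simp add: range_i_iff p.diff)
    then have "i (inv i (e - \<sigma> (p e))) = e - \<sigma> (p e)" by (rule f_inv_into_f)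
    then show "\<Phi> (inv i (e - \<sigma> (p e)), p e) = e" by (simp add: section_iso_def)
  qed
qed

text \<open>
  The maps \<open>r\<close>, \<open>t\<close>, \<open>w\<close> are left arbitrary so that the case \<open>n \<ge> 3\<close> and both binary cases, in which
  one of them is zero, are covered by the same argument.
\<close>
lemma crossed_product_and_iso:
  assumes maps: "crossed_maps n sg sv r t w"
    and hom: "\<And>ps. length ps = n \<Longrightarrow> \<Phi> (crossed_bracket n sg bg bv r t w ps) = be (map \<Phi> ps)"
  shows "crossed_product n sg bg sv bv r t w \<and>
    n_lie_iso n (module_prod.scale sg sv) (crossed_bracket n sg bg bv r t w) se be \<Phi>"
proof -
  have "n_lie_algebra (module_prod.scale sg sv) n (crossed_bracket n sg bg bv r t w)"
    by (rule n_lie_algebra_transport[OF E.n_lie_algebra_axioms linear_section_iso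
          bij_section_iso hom]) (use arity in simp_all)
  then show ?thesis
    using maps hom linear_section_iso bij_section_iso
      G.n_lie_algebra_axioms V.n_lie_algebra_axioms E.n_lie_algebra_axioms
    by (simp add: crossed_product_def n_lie_iso_def n_lie_hom_def)
qed

text \<open>The term of the expansion of \<open>be (map \<Phi> ps)\<close> in which \<open>S\<close> is the set of positions in \<open>V\<close>.\<close>
definition mixed_bracket :: "'g list \<Rightarrow> 'v list \<Rightarrow> nat set \<Rightarrow> 'e"
  where "mixed_bracket xs us S = be (map (\<lambda>k. if k \<in> S then \<sigma> (us ! k) else i (xs ! k)) [0..<n])"

lemma bracket_eq_sum_mixed_brackets:
  assumes "length ps = n"
  shows "be (map \<Phi> ps) = (\<Sum>S\<in>Pow {..<n}. mixed_bracket (map fst ps) (map snd ps) S)"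
proof -
  have "map \<Phi> ps = map (\<lambda>k. \<sigma> (map snd ps ! k) + i (map fst ps ! k)) [0..<n] @ []"
    using assms by (intro nth_equalityI) (simp_all add: section_iso_def case_prod_beta add.commute)
  then show ?thesis
    unfolding mixed_bracket_def
    by (simp only: expand_over_subsets[OF E.alternating, of n "[]", simplified] append_Nil2)
qed

context
  fixes xs :: "'g list" and us :: "'v list"
  assumes len_xs: "length xs = n" and len_us: "length us = n"
begin

lemma mixed_bracket_empty: "mixed_bracket xs us {} = i (bg xs)"
proof -
  have "map (\<lambda>k. i (xs ! k)) [0..<n] = map i xs"
    using len_xs by (intro nth_equalityI) simp_all
  then show ?thesis by (simp add: mixed_bracket_def i_bracket len_xs)
qed

lemma mixed_bracket_full: "mixed_bracket xs us {..<n} = i (\<omega> us) + \<sigma> (bv us)"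
proof -
  have "map (\<lambda>k. if k \<in> {..<n} then \<sigma> (us ! k) else i (xs ! k)) [0..<n] = map \<sigma> us"
    using len_us by (intro nth_equalityI) simp_all
  then show ?thesis by (simp add: mixed_bracket_def i_omega len_us)
qed

lemma mixed_bracket_singleton:
  assumes "j < n"
  shows "mixed_bracket xs us {j} = i (sg ((-1) ^ j) (\<theta> (us ! j) (omit j xs)))"
proof -
  have "map (\<lambda>k. if k \<in> {j} then \<sigma> (us ! k) else i (xs ! k)) [0..<n]
      = (map i xs)[j := \<sigma> (us ! j)]"
    using len_xs assms by (intro nth_equalityI) (auto simp: nth_list_update)
  also have "\<dots> = [] @ take j (map i xs) @ \<sigma> (us ! j) # drop (Suc j) (map i xs)"
    using len_xs assms by (simp add: upd_conv_take_nth_drop)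
  finally have "mixed_bracket xs us {j}
      = be ([] @ take j (map i xs) @ \<sigma> (us ! j) # drop (Suc j) (map i xs))"
    by (simp only: mixed_bracket_def)
  also have "\<dots> = se ((-1) ^ length (take j (map i xs)))
      (be ([] @ \<sigma> (us ! j) # take j (map i xs) @ drop (Suc j) (map i xs)))"
    by (rule move_entry[OF E.alternating]) (use len_xs assms in simp)
  also have "\<dots> = se ((-1) ^ j) (be (\<sigma> (us ! j) # map i (omit j xs)))"
    using len_xs assms by (simp add: omit_def take_map drop_map)
  also have "\<dots> = i (sg ((-1) ^ j) (\<theta> (us ! j) (omit j xs)))"
    using len_xs assms by (simp add: i.scale i_theta omit_def)
  finally show ?thesis .
qed

lemma mixed_bracket_cosingleton:
  assumes "j < n"
  shows "mixed_bracket xs us ({..<n} - {j})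
    = i (sg ((-1) ^ (n - 1 - j)) (\<rho> (omit j us) (xs ! j)))"
proof -
  let ?as = "take j (map \<sigma> us)" and ?bs = "drop (Suc j) (map \<sigma> us)"
  have "map (\<lambda>k. if k \<in> {..<n} - {j} then \<sigma> (us ! k) else i (xs ! k)) [0..<n]
      = (map \<sigma> us)[j := i (xs ! j)]"
    using len_us assms by (intro nth_equalityI) (auto simp: nth_list_update)
  also have "\<dots> = ?as @ i (xs ! j) # ?bs"
    using len_us assms by (simp add: upd_conv_take_nth_drop)
  finally have "mixed_bracket xs us ({..<n} - {j}) = be (?as @ i (xs ! j) # ?bs @ [])"
    by (simp only: mixed_bracket_def append_Nil2)
  moreover have "be (?as @ ?bs @ [i (xs ! j)])
      = se ((-1) ^ length ?bs) (be (?as @ i (xs ! j) # ?bs @ []))"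
    by (rule move_entry[OF E.alternating]) (use len_us assms in simp)
  moreover have "length ?bs = n - 1 - j"
    using len_us by simp
  ultimately have "mixed_bracket xs us ({..<n} - {j})
      = se ((-1) ^ (n - 1 - j)) (be (?as @ ?bs @ [i (xs ! j)]))"
    by (simp flip: power_mult_distrib)
  also have "\<dots> = se ((-1) ^ (n - 1 - j)) (be (map \<sigma> (omit j us) @ [i (xs ! j)]))"
    by (simp add: omit_def take_map drop_map)
  also have "\<dots> = i (sg ((-1) ^ (n - 1 - j)) (\<rho> (omit j us) (xs ! j)))"
    using len_us assms by (simp add: i.scale i_rho omit_def)
  finally show ?thesis .
qed

lemma sum_mixed_brackets_singleton:
  "(\<Sum>j<n. mixed_bracket xs us {j}) = (\<Sum>j<n. i (sg ((-1) ^ j) (\<theta> (us ! j) (omit j xs))))"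
  by (intro sum.cong mixed_bracket_singleton) auto

lemma sum_mixed_brackets_cosingleton:
  "(\<Sum>j<n. mixed_bracket xs us ({..<n} - {j}))
    = (\<Sum>j<n. i (sg ((-1) ^ (n - 1 - j)) (\<rho> (omit j us) (xs ! j))))"
  by (intro sum.cong mixed_bracket_cosingleton) auto

text \<open>
  Sparsity speaks of brackets whose entries from \<open>V\<close> come first; the alternating property extends it
  to every position of these entries.
\<close>
lemma mixed_bracket_vanishes:
  assumes sparse: "sparse n be i \<sigma>"
    and S: "S \<subseteq> {..<n}" and "2 \<le> card S" and "card S + 2 \<le> n"
  shows "mixed_bracket xs us S = 0"
proof -
  let ?c = "\<lambda>k. if k \<in> S then \<sigma> (us ! k) else i (xs ! k)"
  let ?in = "filter (\<lambda>k. k \<in> S) [0..<n]" and ?out = "filter (\<lambda>k. k \<notin> S) [0..<n]"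
  have "set ?in = S" using S by auto
  then have len_in: "length ?in = card S"
    by (metis distinct_card distinct_filter distinct_upt)
  have len_out: "length ?out = n - card S"
    using sum_length_filter_compl[of "\<lambda>k. k \<in> S" "[0..<n]"] len_in by simp
  have "map ?c ?in = map \<sigma> (map (nth us) ?in)" and "map ?c ?out = map i (map (nth xs) ?out)"
    by simp_all
  then have "be ([] @ map ?c ?in @ map ?c ?out) = 0"
    using sparse assms(3,4) len_in len_out
    by (simp only: append_Nil) (simp add: sparse_def del: map_map)
  then have "be ([] @ map ?c [0..<n]) = 0"
    by (intro vanishing_from_sorted[OF E.alternating]) simp_all
  then show ?thesis by (simp add: mixed_bracket_def)
qed

end

lemma section_iso_crossed_bracket:
  assumes "length ps = n"
  shows "\<Phi> (crossed_bracket n sg bg bv r t w ps) =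
    i (bg (map fst ps)) + (i (w (map snd ps)) + \<sigma> (bv (map snd ps)))
      + (\<Sum>j<n. i (sg ((-1) ^ j) (t (map snd ps ! j) (omit j (map fst ps)))))
      + (\<Sum>j<n. i (sg ((-1) ^ (n - 1 - j)) (r (omit j (map snd ps)) (map fst ps ! j))))"
  by (simp add: section_iso_def crossed_bracket_def Let_def i.add i.sum algebra_simps)

lemma crossed_product_of_sparse_section:
  assumes "n \<ge> 3" and sparse: "sparse n be i \<sigma>"
  shows "crossed_product n sg bg sv bv \<rho> \<theta> \<omega> \<and>
    n_lie_iso n (module_prod.scale sg sv) (crossed_bracket n sg bg bv \<rho> \<theta> \<omega>) se be \<Phi>"
proof (rule crossed_product_and_iso[OF crossed_maps_section])
  fix ps :: "('g \<times> 'v) list"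
  assume len: "length ps = n"
  let ?F = "mixed_bracket (map fst ps) (map snd ps)"
  have len': "length (map fst ps) = n" "length (map snd ps) = n" using len by simp_all
  have "be (map \<Phi> ps) = ?F {} + ?F {..<n} + (\<Sum>j<n. ?F {j}) + (\<Sum>j<n. ?F ({..<n} - {j}))"
    unfolding bracket_eq_sum_mixed_brackets[OF len]
    by (rule sum_over_small_and_cosmall_subsets[OF \<open>n \<ge> 3\<close>])
      (rule mixed_bracket_vanishes[OF len' sparse])
  then show "\<Phi> (crossed_bracket n sg bg bv \<rho> \<theta> \<omega> ps) = be (map \<Phi> ps)"
    by (simp only: section_iso_crossed_bracket[OF len] mixed_bracket_empty[OF len']
        mixed_bracket_full[OF len'] sum_mixed_brackets_singleton[OF len']
        sum_mixed_brackets_cosingleton[OF len'])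
qed

text \<open>
  The brackets with entries of both kinds have exactly one of each, so the mixed terms may be indexed
  by the position of the entry from \<open>V\<close>, which gives \<open>\<theta>\<close>, or by that of the entry from \<open>g\<close>,
  which gives \<open>\<rho>\<close>.
\<close>
lemma crossed_products_of_binary_section:
  assumes "n = 2"
  shows "crossed_product n sg bg sv bv zero_map \<theta> \<omega> \<and>
    n_lie_iso n (module_prod.scale sg sv) (crossed_bracket n sg bg bv zero_map \<theta> \<omega>) se be \<Phi>"
    and "crossed_product n sg bg sv bv \<rho> zero_map \<omega> \<and>
    n_lie_iso n (module_prod.scale sg sv) (crossed_bracket n sg bg bv \<rho> zero_map \<omega>) se be \<Phi>"
proof -
  have expansion: "be (map \<Phi> ps) = mixed_bracket (map fst ps) (map snd ps) {}
      + mixed_bracket (map fst ps) (map snd ps) {..<n}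
      + (\<Sum>j<n. mixed_bracket (map fst ps) (map snd ps) {j})"
    if "length ps = n" for ps
    unfolding bracket_eq_sum_mixed_brackets[OF that] using assms
    by (simp only: sum_over_subsets_of_two)
  note vs = G.vector_space_axioms V.vector_space_axioms
  show "crossed_product n sg bg sv bv zero_map \<theta> \<omega> \<and>
    n_lie_iso n (module_prod.scale sg sv) (crossed_bracket n sg bg bv zero_map \<theta> \<omega>) se be \<Phi>"
  proof (rule crossed_product_and_iso[OF crossed_maps_zero_rho[OF crossed_maps_section vs]])
    fix ps :: "('g \<times> 'v) list"
    assume len: "length ps = n"
    then have len': "length (map fst ps) = n" "length (map snd ps) = n" by simp_all
    have "(\<Sum>j<n. i (sg ((-1) ^ (n - 1 - j)) (zero_map (omit j (map snd ps)) (map fst ps ! j)))) = 0"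
      by (simp add: zero_map_def)
    then show "\<Phi> (crossed_bracket n sg bg bv zero_map \<theta> \<omega> ps) = be (map \<Phi> ps)"
      by (simp only: section_iso_crossed_bracket[OF len] expansion[OF len]
          mixed_bracket_empty[OF len'] mixed_bracket_full[OF len']
          sum_mixed_brackets_singleton[OF len'] add_0_right)
  qed
  show "crossed_product n sg bg sv bv \<rho> zero_map \<omega> \<and>
    n_lie_iso n (module_prod.scale sg sv) (crossed_bracket n sg bg bv \<rho> zero_map \<omega>) se be \<Phi>"
  proof (rule crossed_product_and_iso[OF crossed_maps_zero_theta[OF crossed_maps_section vs]])
    fix ps :: "('g \<times> 'v) list"
    assume len: "length ps = n"
    then have len': "length (map fst ps) = n" "length (map snd ps) = n" by simp_all
    let ?F = "mixed_bracket (map fst ps) (map snd ps)"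
    \<comment> \<open>Complementation exchanges the two singletons.\<close>
    have "{..<2::nat} = {0, 1}" by auto
    then have "{..<2::nat} - {0} = {1}" "{..<2::nat} - {1} = {0}" by auto
    then have swap: "(\<Sum>j<n. ?F {j}) = (\<Sum>j<n. ?F ({..<n} - {j}))"
      using \<open>{..<2::nat} = {0, 1}\<close> by (simp add: assms add.commute)
    have "(\<Sum>j<n. i (sg ((-1) ^ j) (zero_map (map snd ps ! j) (omit j (map fst ps))))) = 0"
      by (simp add: zero_map_def)
    then show "\<Phi> (crossed_bracket n sg bg bv \<rho> zero_map \<omega> ps) = be (map \<Phi> ps)"
      by (simp only: section_iso_crossed_bracket[OF len] expansion[OF len] swap
          mixed_bracket_empty[OF len'] mixed_bracket_full[OF len']
          sum_mixed_brackets_cosingleton[OF len'] add_0_right)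
  qed
qed

end

section \<open>The extension defined by a crossed product\<close>

lemma zero_in_set_omit:
  assumes "j < length xs" and "k < length xs" and "k \<noteq> j" and "xs ! k = z"
  shows "z \<in> set (omit j xs)"
proof (cases "k < j")
  case True
  then have "z \<in> set (take j xs)"
    using assms by (auto simp: in_set_conv_nth intro!: exI[of _ k])
  then show ?thesis by (simp add: omit_def)
next
  case False
  then have "z \<in> set (drop (Suc j) xs)"
    using assms by (auto simp: in_set_conv_nth intro!: exI[of _ "k - Suc j"])
  then show ?thesis by (simp add: omit_def)
qed

locale crossed =
  fixes n :: nat
    and sg :: "'k::field_char_0 \<Rightarrow> 'g::ab_group_add \<Rightarrow> 'g" and bg :: "'g list \<Rightarrow> 'g"
    and sv :: "'k \<Rightarrow> 'v::ab_group_add \<Rightarrow> 'v" and bv :: "'v list \<Rightarrow> 'v"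
    and \<rho> :: "'v list \<Rightarrow> 'g \<Rightarrow> 'g" and \<theta> :: "'v \<Rightarrow> 'g list \<Rightarrow> 'g" and \<omega> :: "'v list \<Rightarrow> 'g"
  assumes arity: "n \<ge> 2"
    and crossed_product: "crossed_product n sg bg sv bv \<rho> \<theta> \<omega>"
begin

sublocale G: n_lie_algebra sg n bg
  using crossed_product by (simp add: crossed_product_def)

sublocale V: n_lie_algebra sv n bv
  using crossed_product by (simp add: crossed_product_def)

sublocale P: vector_space_prod sg sv
  by (intro vector_space_prod.intro vector_space_pair.intro)
    (fact G.vector_space_axioms V.vector_space_axioms)+

lemma alternating_rho: "alternating_map (n - 1) sv sg (\<lambda>us. \<rho> us x)"
  and alternating_theta: "alternating_map (n - 1) sg sg (\<theta> u)"
  and alternating_omega: "alternating_map n sv sg \<omega>"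
  using crossed_product by (simp_all add: crossed_product_def crossed_maps_def)

lemma theta_zero: "length xs = n - 1 \<Longrightarrow> \<theta> 0 xs = 0"
  using crossed_product unfolding crossed_product_def crossed_maps_def Vector_Spaces.linear_iff
  by (metis add_cancel_right_right)

lemma rho_zero: "length us = n - 1 \<Longrightarrow> \<rho> us 0 = 0"
  using crossed_product unfolding crossed_product_def crossed_maps_def Vector_Spaces.linear_iff
  by (metis add_cancel_right_right)

text \<open>
  The terms with \<open>\<rho>\<close> vanish because \<open>n - 1 \<ge> 1\<close> zero arguments remain when one position is omitted.
\<close>
lemma crossed_bracket_inclusion:
  assumes "length xs = n"
  shows "crossed_bracket n sg bg bv \<rho> \<theta> \<omega> (map (\<lambda>x. (x, 0)) xs) = (bg xs, 0)"
proof -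
  let ?us = "replicate n (0::'v)"
  have us: "map (\<lambda>x. 0::'v) xs = ?us"
    using assms by (simp add: map_replicate_const)
  have "0 \<in> set ?us" using arity by simp
  then have "\<omega> ?us = 0" "bv ?us = 0"
    by (intro alternating_map_zero[OF alternating_omega] alternating_map_zero[OF V.alternating];
        simp)+
  moreover have "\<theta> (?us ! j) (omit j xs) = 0" if "j < n" for j
    using that assms by (simp add: theta_zero omit_def)
  moreover have "\<rho> (omit j ?us) x = 0" if "j < n" for j x
  proof (rule alternating_map_zero[OF alternating_rho])
    show "length (omit j ?us) = n - 1" using that by (simp add: omit_def)
    then show "0 \<in> set (omit j ?us)"
      using arity by (auto simp: omit_def)
  qed
  ultimately show ?thesis
    using assms by (simp add: crossed_bracket_def Let_def o_def us)
qed

lemma extension: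
  "n_lie_extension n sg bg (module_prod.scale sg sv) (crossed_bracket n sg bg bv \<rho> \<theta> \<omega>)
    sv bv (\<lambda>x. (x, 0)) snd"
proof -
  have "Vector_Spaces.linear sg (module_prod.scale sg sv) (\<lambda>x. (x, 0))"
    "Vector_Spaces.linear (module_prod.scale sg sv) sv snd"
    using G.vector_space_axioms V.vector_space_axioms P.p.vector_space_axioms
    by (auto simp: Vector_Spaces.linear_iff P.scale_def)
  moreover have "snd (crossed_bracket n sg bg bv \<rho> \<theta> \<omega> ps) = bv (map snd ps)" for ps
    by (simp add: crossed_bracket_def Let_def)
  moreover have "range (\<lambda>x. (x, 0)) = {e :: 'g \<times> 'v. snd e = 0}"
    by (auto simp: image_iff)
  moreover have "inj (\<lambda>x. (x :: 'g, 0 :: 'v))" "surj (snd :: 'g \<times> 'v \<Rightarrow> 'v)"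
    by (auto simp: inj_def)
  ultimately show ?thesis
    using crossed_product crossed_bracket_inclusion
    by (simp add: n_lie_extension_def n_lie_hom_def crossed_product_def)
qed

lemma linear_section_canonical:
  "linear_section (module_prod.scale sg sv) sv snd (\<lambda>u. (0, u))"
  using V.vector_space_axioms P.p.vector_space_axioms
  by (auto simp: linear_section_def Vector_Spaces.linear_iff P.scale_def)

lemma sparse_canonical:
  "sparse n (crossed_bracket n sg bg bv \<rho> \<theta> \<omega>) (\<lambda>x. (x, 0)) (\<lambda>u. (0, u))"
  unfolding sparse_def
proof (intro allI impI, elim conjE)
  fix k and us :: "'v list" and xs :: "'g list"
  assume k: "2 \<le> k" "k + 2 \<le> n" and len: "length us = k" "length xs = n - k"
  define ys where "ys = replicate k 0 @ xs"
  define ws where "ws = us @ replicate (n - k) 0"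
  have ps: "map fst (map (\<lambda>u. (0, u)) us @ map (\<lambda>x. (x, 0)) xs) = ys"
    "map snd (map (\<lambda>u. (0, u)) us @ map (\<lambda>x. (x, 0)) xs) = ws"
    using len by (simp_all add: ys_def ws_def o_def map_replicate_const)
  have len': "length ys = n" "length ws = n"
    using k len by (simp_all add: ys_def ws_def)
  \<comment> \<open>Two zeros each: whichever position is omitted, one of them is left.\<close>
  have ys_zero: "ys ! 0 = 0" "ys ! 1 = 0"
    using k len by (simp_all add: ys_def nth_append)
  have ws_zero: "ws ! (n - 1) = 0" "ws ! (n - 2) = 0"
    using k len by (auto simp: ws_def nth_append)
  have "0 \<in> set ys" "0 \<in> set ws"
    using k by (simp_all add: ys_def ws_def)
  then have "bg ys = 0" "bv ws = 0" "\<omega> ws = 0"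
    by (auto intro!: alternating_map_zero[OF G.alternating] alternating_map_zero[OF V.alternating]
        alternating_map_zero[OF alternating_omega] len')
  moreover have "\<theta> u (omit j ys) = 0" if "j < n" for j u
  proof (rule alternating_map_zero[OF alternating_theta])
    show "length (omit j ys) = n - 1" using that len' by (simp add: omit_def)
    show "0 \<in> set (omit j ys)"
      using that len' ys_zero k zero_in_set_omit[of j ys 0] zero_in_set_omit[of j ys 1]
      by (cases "j = 0") auto
  qed
  moreover have "\<rho> (omit j ws) x = 0" if "j < n" for j x
  proof (rule alternating_map_zero[OF alternating_rho])
    show "length (omit j ws) = n - 1" using that len' by (simp add: omit_def)
    show "0 \<in> set (omit j ws)"
      using that len' ws_zero k zero_in_set_omit[of j ws "n - 1"] zero_in_set_omit[of j ws "n - 2"]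
      by (cases "j = n - 1") auto
  qed
  ultimately show "crossed_bracket n sg bg bv \<rho> \<theta> \<omega>
      (map (\<lambda>u. (0, u)) us @ map (\<lambda>x. (x, 0)) xs) = 0"
    unfolding crossed_bracket_def Let_def ps by (simp add: zero_prod_def)
qed

end

theorem theorem5p5:
  fixes n :: nat
    and sg :: "'k::field_char_0 \<Rightarrow> 'g::ab_group_add \<Rightarrow> 'g" and bg :: "'g list \<Rightarrow> 'g"
    and se :: "'k \<Rightarrow> 'e::ab_group_add \<Rightarrow> 'e" and be :: "'e list \<Rightarrow> 'e"
    and sv :: "'k \<Rightarrow> 'v::ab_group_add \<Rightarrow> 'v" and bv :: "'v list \<Rightarrow> 'v"
    and i :: "'g \<Rightarrow> 'e" and p :: "'e \<Rightarrow> 'v" and \<sigma> :: "'v \<Rightarrow> 'e"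
    and \<rho>' :: "'v list \<Rightarrow> 'g \<Rightarrow> 'g" and \<theta>' :: "'v \<Rightarrow> 'g list \<Rightarrow> 'g" and \<omega>' :: "'v list \<Rightarrow> 'g"
  defines "\<theta> \<equiv> section_theta be i \<sigma>"
    and "\<rho> \<equiv> section_rho be i \<sigma>"
    and "\<omega> \<equiv> section_omega be bv i \<sigma>"
  assumes "n \<ge> 2"
  shows
    "(n_lie_extension n sg bg se be sv bv i p \<and> linear_section se sv p \<sigma> \<and> sparse n be i \<sigma> \<longrightarrow>
        (\<forall>u xs. length xs = n - 1 \<longrightarrow> be (\<sigma> u # map i xs) \<in> range i) \<and>
        (\<forall>us x. length us = n - 1 \<longrightarrow> be (map \<sigma> us @ [i x]) \<in> range i) \<and>
        (\<forall>us. length us = n \<longrightarrow> be (map \<sigma> us) - \<sigma> (bv us) \<in> range i) \<and>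
        crossed_maps n sg sv \<rho> \<theta> \<omega> \<and>
        (n \<ge> 3 \<longrightarrow>
          crossed_product n sg bg sv bv \<rho> \<theta> \<omega> \<and>
          n_lie_iso n (module_prod.scale sg sv) (crossed_bracket n sg bg bv \<rho> \<theta> \<omega>)
            se be (section_iso i \<sigma>)) \<and>
        (n = 2 \<longrightarrow>
          crossed_product n sg bg sv bv zero_map \<theta> \<omega> \<and>
          n_lie_iso n (module_prod.scale sg sv) (crossed_bracket n sg bg bv zero_map \<theta> \<omega>)
            se be (section_iso i \<sigma>) \<and>
          crossed_product n sg bg sv bv \<rho> zero_map \<omega> \<and>
          n_lie_iso n (module_prod.scale sg sv) (crossed_bracket n sg bg bv \<rho> zero_map \<omega>)
            se be (section_iso i \<sigma>))) \<and>
     (crossed_product n sg bg sv bv \<rho>' \<theta>' \<omega>' \<longrightarrow>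
        n_lie_extension n sg bg (module_prod.scale sg sv) (crossed_bracket n sg bg bv \<rho>' \<theta>' \<omega>')
          sv bv (\<lambda>x. (x, 0)) snd \<and>
        linear_section (module_prod.scale sg sv) sv snd (\<lambda>u. (0, u)) \<and>
        sparse n (crossed_bracket n sg bg bv \<rho>' \<theta>' \<omega>') (\<lambda>x. (x, 0)) (\<lambda>u. (0, u)))"
proof (intro conjI impI)
  assume *: "n_lie_extension n sg bg se be sv bv i p \<and> linear_section se sv p \<sigma> \<and>
    sparse n be i \<sigma>"
  interpret X: sectioned_extension n sg bg se be sv bv i p \<sigma>
    by unfold_locales (use * \<open>n \<ge> 2\<close> in auto)
  show "\<forall>u xs. length xs = n - 1 \<longrightarrow> be (\<sigma> u # map i xs) \<in> range i"
    using X.theta_in_range by blast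
  show "\<forall>us x. length us = n - 1 \<longrightarrow> be (map \<sigma> us @ [i x]) \<in> range i"
    using X.rho_in_range by blast
  show "\<forall>us. length us = n \<longrightarrow> be (map \<sigma> us) - \<sigma> (bv us) \<in> range i"
    using X.omega_in_range by blast
  show "crossed_maps n sg sv \<rho> \<theta> \<omega>"
    unfolding \<theta>_def \<rho>_def \<omega>_def by (rule X.crossed_maps_section)
  {
    assume "n \<ge> 3"
    from X.crossed_product_of_sparse_section[OF this] *
    show "crossed_product n sg bg sv bv \<rho> \<theta> \<omega>"
      "n_lie_iso n (module_prod.scale sg sv) (crossed_bracket n sg bg bv \<rho> \<theta> \<omega>)
        se be (section_iso i \<sigma>)"
      unfolding \<theta>_def \<rho>_def \<omega>_def by blast+
  }
  {
    assume "n = 2"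
    note binary = X.crossed_products_of_binary_section[OF this]
    show "crossed_product n sg bg sv bv zero_map \<theta> \<omega>"
      "n_lie_iso n (module_prod.scale sg sv) (crossed_bracket n sg bg bv zero_map \<theta> \<omega>)
        se be (section_iso i \<sigma>)"
      "crossed_product n sg bg sv bv \<rho> zero_map \<omega>"
      "n_lie_iso n (module_prod.scale sg sv) (crossed_bracket n sg bg bv \<rho> zero_map \<omega>)
        se be (section_iso i \<sigma>)"
      using binary unfolding \<theta>_def \<rho>_def \<omega>_def by blast+
  }
next
  assume "crossed_product n sg bg sv bv \<rho>' \<theta>' \<omega>'"
  then interpret C: crossed n sg bg sv bv \<rho>' \<theta>' \<omega>'
    by unfold_locales (use \<open>n \<ge> 2\<close> in auto)
  show "n_lie_extension n sg bg (module_prod.scale sg sv) (crossed_bracket n sg bg bv \<rho>' \<theta>' \<omega>')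
      sv bv (\<lambda>x. (x, 0)) snd"
    by (rule C.extension)
  show "linear_section (module_prod.scale sg sv) sv snd (\<lambda>u. (0, u))"
    by (rule C.linear_section_canonical)
  show "sparse n (crossed_bracket n sg bg bv \<rho>' \<theta>' \<omega>') (\<lambda>x. (x, 0)) (\<lambda>u. (0, u))"
    by (rule C.sparse_canonical)
qed

end
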